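(* The characters $\chi_{\mathbf{v}}$, $\mathbf{v}\in\mathbb{F}_q^{n+d}$, are eigenvectors of $\phi_f$ as follows: the single character with $\mathbf{v}=\mathbf{0}$ has eigenvalue $q^{(d+1)n}$; the $q^{n+d}-q^n$ characters with $\mathbf{v}|_{[n+1,n+d]}\ne\mathbf{0}$ have eigenvalue $q^{dn}$; the $q^n-1$ characters with $\mathbf{v}\ne\mathbf{0}$ and $\mathbf{v}|_{[n+1,n+d]}=\mathbf{0}$ have eigenvalue $0$.
   Context: $q=p^m$ is a prime power, $n,d$ positive integers. $\mathrm{Tr}:\mathbb{F}_q\to\mathbb{F}_p$ is the trace, $e(x)=e^{2\pi i x/p}$, $\chi_{\mathbf{v}}=\sum_{\mathbf{u}\in\mathbb{F}_q^{n+d}}e(\mathrm{Tr}(\langle\mathbf{v},\mathbf{u}\rangle))x_{\mathbf{u}}\in\mathbb{C}[\mathbb{F}_q^{n+d}]$. The group algebra has product $(\sum c_{\mathbf{u}}x_{\mathbf{u}})(\sum\tilde c_{\mathbf{u}}x_{\mathbf{u}})=\sum_{\mathbf{u}}(\sum_{\tilde{\mathbf{u}}}c_{\mathbf{u}-\tilde{\mathbf{u}}}\tilde c_{\tilde{\mathbf{u}}})x_{\mathbf{u}}$; $\phi_z(g)=z\cdot g$. Here $f=\sum_{\mathbf{u}}c_{\mathbf{u}}x_{\mathbf{u}}$ with $c_{\mathbf{u}}=q^{dn}$ if $\mathbf{u}=\mathbf{0}$, $q^{d(n-1)}$ if $\mathbf{u}|_{[n]}\ne\mathbf{0}$, and $0$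 otherwise. $\mathbf{v}|_{[n]}$, $\mathbf{v}|_{[n+1,n+d]}$ are the first $n$ and last $d$ coordinates. *)

theory Defs
  imports "HOL-Analysis.Analysis" "HOL-Library.Poly_Mapping" "HOL-Number_Theory.Cong"
begin

text \<open>
  The field \<open>F\<^sub>q\<close> is a type \<open>'a :: {field, finite}\<close> with \<open>CARD('a) = q = p ^ m\<close>.
  A vector of \<open>F\<^sub>q\<close> to the power \<open>n + d\<close> has type \<open>('a, 'n + 'd) vec\<close> with \<open>CARD('n) = n\<close>
  and \<open>CARD('d) = d\<close>: the indices \<open>Inl i\<close> are the first \<open>n\<close> coordinates, the indices
  \<open>Inr j\<close> the last \<open>d\<close>. The group algebra of the additive group \<open>'v\<close> over \<open>complex\<close> is
  \<open>'v \<Rightarrow>\<^sub>0 complex\<close>, whose product is convolution; the basis element \<open>x\<^sub>u\<close> is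
  \<open>Poly_Mapping.single u 1\<close>.
\<close>

definition first_coords :: "('a, 'n::finite + 'd::finite) vec \<Rightarrow> ('a, 'n) vec"
  where "first_coords u = (\<chi> i. u $ Inl i)"

definition last_coords :: "('a, 'n::finite + 'd::finite) vec \<Rightarrow> ('a, 'd) vec"
  where "last_coords u = (\<chi> j. u $ Inr j)"

definition pairing :: "('a::comm_semiring_1, 'k::finite) vec \<Rightarrow> ('a, 'k) vec \<Rightarrow> 'a"
  where "pairing v u = (\<Sum>i\<in>UNIV. v $ i * u $ i)"

text \<open>
  The trace from \<open>F\<^sub>q\<close> to \<open>F\<^sub>p\<close> for \<open>q = p ^ m\<close>, as the sum of the Galois conjugates;
  \<open>F\<^sub>p\<close> is the prime subfield \<open>range of_nat\<close> of \<open>'a\<close>.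
\<close>

definition field_trace :: "nat \<Rightarrow> nat \<Rightarrow> 'a::comm_semiring_1 \<Rightarrow> 'a"
  where "field_trace p m x = (\<Sum>i<m. x ^ (p ^ i))"

text \<open>Only meaningful for \<open>x\<close> in the prime subfield; \<open>k\<close> is its representative below \<open>p\<close>.\<close>

definition add_char :: "nat \<Rightarrow> 'a::semiring_1 \<Rightarrow> complex"
  where "add_char p x =
    (let k = (THE k::nat. k < p \<and> of_nat k = x)
     in exp (2 * of_real pi * \<i> * of_nat k / of_nat p))"

lemma add_char_of_nat:
  assumes "CHAR('a::ring_1) = p" "p > 0"
  shows "add_char p (of_nat j :: 'a) = exp (2 * of_real pi * \<i> * of_nat j / of_nat p)"
proof -
  have "(THE k::nat. k < p \<and> of_nat k = (of_nat j :: 'a)) = j mod p"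
  proof (rule the_equality)
    show "j mod p < p \<and> of_nat (j mod p) = (of_nat j :: 'a)"
      using assms by (auto simp: of_nat_eq_iff_cong_CHAR cong_def)
  next
    fix k :: nat
    assume "k < p \<and> of_nat k = (of_nat j :: 'a)"
    then show "k = j mod p"
      using assms by (auto simp: of_nat_eq_iff_cong_CHAR cong_def)
  qed
  moreover have "exp (2 * of_real pi * \<i> * of_nat (j mod p) / of_nat p :: complex) =
      exp (2 * of_real pi * \<i> * of_nat j / of_nat p)"
  proof -
    have j: "(of_nat j :: complex) = of_nat (j div p) * of_nat p + of_nat (j mod p)"
      by (metis div_mult_mod_eq of_nat_add of_nat_mult)
    have "2 * of_real pi * \<i> * of_nat j / of_nat p =
        2 * of_real pi * \<i> * of_nat (j mod p) / of_nat p
          + of_real (of_int (2 * int (j div p)) * pi) * \<i>"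
      using assms(2) unfolding j by (simp add: field_simps)
    then show ?thesis
      by (metis exp_eq)
  qed
  ultimately show ?thesis
    by (simp add: add_char_def)
qed

lemma lookup_mult_group_algebra:
  fixes g h :: "'v::{ab_group_add, finite} \<Rightarrow>\<^sub>0 complex"
  shows "Poly_Mapping.lookup (g * h) u =
    (\<Sum>w\<in>UNIV. Poly_Mapping.lookup g (u - w) * Poly_Mapping.lookup h w)"
proof -
  have inner: "Sum_any (\<lambda>q. Poly_Mapping.lookup g q when u = l + q) = Poly_Mapping.lookup g (u - l)"
    for l
  proof -
    have "(u = l + q) = (u - l = q)" for q
      by (auto simp: algebra_simps)
    then show ?thesis
      by simp
  qed
  have "Poly_Mapping.lookup (h * g) u =
      Sum_any (\<lambda>l. Poly_Mapping.lookup h l * Poly_Mapping.lookup g (u - l))"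
    by (simp only: lookup_mult inner)
  also have "\<dots> = (\<Sum>w\<in>UNIV. Poly_Mapping.lookup h w * Poly_Mapping.lookup g (u - w))"
    by (rule Sum_any.expand_superset) auto
  finally show ?thesis
    by (simp add: mult.commute)
qed

definition character ::
    "nat \<Rightarrow> nat \<Rightarrow> ('a::{field, finite}, 'k::finite) vec \<Rightarrow> (('a, 'k) vec \<Rightarrow>\<^sub>0 complex)"
  where "character p m v =
    (\<Sum>u\<in>UNIV. Poly_Mapping.single u (add_char p (field_trace p m (pairing v u))))"

definition f_coeff :: "('a::{field, finite}, 'n::finite + 'd::finite) vec \<Rightarrow> complex"
  where "f_coeff u =
    (if u = 0 then of_nat CARD('a) ^ (CARD('d) * CARD('n))
     else if first_coords u \<noteq> 0 then of_nat CARD('a) ^ (CARD('d) * (CARD('n) - 1))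
     else 0)"

definition f_elem :: "('a::{field, finite}, 'n::finite + 'd::finite) vec \<Rightarrow>\<^sub>0 complex"
  where "f_elem = (\<Sum>u\<in>UNIV. Poly_Mapping.single u (f_coeff u))"

definition phi :: "('v::monoid_add \<Rightarrow>\<^sub>0 complex) \<Rightarrow> ('v \<Rightarrow>\<^sub>0 complex) \<Rightarrow> ('v \<Rightarrow>\<^sub>0 complex)"
  where "phi z g = z * g"

definition scale :: "complex \<Rightarrow> ('v \<Rightarrow>\<^sub>0 complex) \<Rightarrow> ('v \<Rightarrow>\<^sub>0 complex)"
  where "scale c g = Poly_Mapping.map ((*) c) g"

definition is_eigenvector ::
    "(('v \<Rightarrow>\<^sub>0 complex) \<Rightarrow> ('v \<Rightarrow>\<^sub>0 complex)) \<Rightarrow> ('v \<Rightarrow>\<^sub>0 complex) \<Rightarrow> complex \<Rightarrow> bool"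
  where "is_eigenvector T g c \<longleftrightarrow> g \<noteq> 0 \<and> T g = scale c g"

end

theory Submission
  imports Defs "HOL-Computational_Algebra.Polynomial"
begin

text \<open>
  Multiplication by \<open>F\<close> is convolution, so every character of the additive group is an eigenvector,
  with eigenvalue the Fourier coefficient of \<open>f_coeff\<close> at \<open>- v\<close>. Since \<open>f_coeff\<close> is a combination of
  the indicators of the whole space, of the subspace \<open>{w. first_coords w = 0}\<close> and of \<open>{0}\<close>,
  orthogonality of characters on these subspaces gives the three eigenvalues. Distinct vectors give
  distinct characters because the trace is not identically zero: it is a polynomial of degree
  \<open>p ^ (m - 1) < q\<close>.
\<close>

subsection \<open>The trace of a finite field\<close>

text \<open>Translation by 1 permutes the field, so comparing the sum of all elements with itself
  gives \<open>of_nat CARD('a) = 0\<close>. Hence the characteristic, a prime, divides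
  \<open>p ^ m\<close>.\<close>

lemma CHAR_eq_of_CARD_prime_power:
  assumes "prime p" "CARD('a::{field, finite}) = p ^ m"
  shows "CHAR('a) = p"
proof -
  have "prime CHAR('a)"
    by (intro prime_CHAR_semidom finite_imp_CHAR_pos) simp
  moreover have "CHAR('a) dvd p ^ m"
  proof -
    have "(\<Sum>x\<in>UNIV. x + 1 :: 'a) = (\<Sum>x\<in>UNIV. x)"
      by (rule sum.reindex_bij_witness[of _ "\<lambda>x. x - 1" "\<lambda>x. x + 1"]) auto
    then have "of_nat CARD('a) = (0::'a)"
      by (simp add: sum.distrib)
    then show ?thesis
      using assms(2) by (simp only: of_nat_eq_0_iff_char_dvd)
  qed
  ultimately show ?thesis
    using assms(1) by (meson prime_dvd_power primes_dvd_imp_eq)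
qed

lemma power_CARD_eq_same:
  fixes x :: "'a::{field, finite}"
  shows "x ^ CARD('a) = x"
proof (cases "x = 0")
  case True
  then show ?thesis
    by (simp only: zero_power[OF zero_less_card_finite])
next
  case False
  let ?U = "UNIV - {0::'a}"
  have "bij_betw ((*) x) ?U ?U"
    by (rule bij_betw_byWitness[where f' = "\<lambda>y. y / x"]) (use False in auto)
  then have "(\<Prod>y\<in>?U. x * y) = \<Prod>?U"
    by (rule prod.reindex_bij_betw)
  then have "x ^ card ?U * \<Prod>?U = \<Prod>?U"
    by (simp add: prod.distrib)
  then have "x ^ card ?U = 1"
    by simp
  moreover have "CARD('a) = Suc (card ?U)"
    by (rule card_Suc_Diff1[symmetric]) simp_all
  ultimately show ?thesis
    by (simp only: power_Suc mult_1_right)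
qed

lemma field_trace_add:
  fixes x y :: "'a::comm_semiring_1"
  assumes "prime p" "CHAR('a) = p"
  shows "field_trace p m (x + y) = field_trace p m x + field_trace p m y"
  using assms by (simp add: field_trace_def freshmans_dream' sum.distrib)

text \<open>Frobenius shifts the conjugates by one place. The term \<open>x\<close> drops out in
  front and \<open>x ^ p ^ m = x\<close> returns at the end.\<close>

lemma field_trace_power:
  fixes x :: "'a::{field, finite}"
  assumes "prime p" "CARD('a) = p ^ m"
  shows "field_trace p m x ^ p = field_trace p m x"
proof -
  have p: "CHAR('a) = p"
    using assms by (rule CHAR_eq_of_CARD_prime_power)
  have "field_trace p m x ^ p = (\<Sum>i<m. x ^ p ^ Suc i)"
    using assms(1) p
    by (simp add: field_trace_def freshmans_dream_sum mult.commute flip: power_mult)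
  also have "\<dots> = (\<Sum>i<Suc m. x ^ p ^ i) - x"
    by (subst sum.lessThan_Suc_shift) simp
  also have "\<dots> = field_trace p m x"
    using power_CARD_eq_same[of x] assms(2) by (simp add: field_trace_def)
  finally show ?thesis .
qed

text \<open>The polynomial \<open>X ^ p - X\<close> has at most \<open>p\<close> roots, and the
  \<open>p\<close> distinct elements \<open>of_nat j\<close> with \<open>j < p\<close> already
  exhaust them. Together with \<open>field_trace_power\<close> this puts traces into the prime
  subfield, where \<open>add_char\<close> is meaningful.\<close>

lemma power_prime_eq_same_imp_of_nat:
  fixes x :: "'a::field"
  assumes "prime p" "CHAR('a) = p" "x ^ p = x"
  obtains j where "j < p" "x = of_nat j"
proof -
  let ?P = "monom 1 p - monom 1 1 :: 'a poly"
  have p: "p > 1"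
    using assms(1) prime_gt_1_nat by blast
  have frob: "(of_nat j :: 'a) ^ p = of_nat j" for j
  proof (induction j)
    case 0
    then show ?case
      using p by (simp add: power_0_left)
  next
    case (Suc j)
    have "(1 + of_nat j :: 'a) ^ p = 1 ^ p + of_nat j ^ p"
      by (rule freshmans_dream) (use assms in simp_all)
    then show ?case
      using Suc by simp
  qed
  have deg: "degree ?P = p"
    unfolding diff_conv_add_uminus
    by (subst degree_add_eq_left) (use p in \<open>simp_all add: degree_monom_eq\<close>)
  then have nz: "?P \<noteq> 0"
    using p by (intro notI) simp
  have poly: "poly ?P y = y ^ p - y" for y
    by (simp add: poly_monom)
  have inj: "inj_on (of_nat :: nat \<Rightarrow> 'a) {..<p}"
    using assms(2) by (auto simp: inj_on_def of_nat_eq_iff_cong_CHAR cong_def)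
  have "of_nat ` {..<p} = {y. poly ?P y = 0}"
  proof (rule card_seteq)
    show "finite {y. poly ?P y = 0}"
      using nz by (rule poly_roots_finite)
    show "of_nat ` {..<p} \<subseteq> {y. poly ?P y = 0}"
      using frob unfolding poly by auto
    have "card (of_nat ` {..<p} :: 'a set) = p"
      using card_image[OF inj] by simp
    then show "card {y. poly ?P y = 0} \<le> card (of_nat ` {..<p} :: 'a set)"
      using card_poly_roots_bound[OF nz] deg by simp
  qed
  moreover have "x \<in> {y. poly ?P y = 0}"
    using assms(3) unfolding poly by simp
  ultimately have "x \<in> of_nat ` {..<p}"
    by (simp only:)
  then show ?thesis
    by (elim imageE) (simp add: that)
qed

lemma field_trace_nonzero:
  assumes "prime p" "CARD('a) = p ^ m"
  obtains x :: "'a::{field, finite}" where "field_trace p m x \<noteq> 0"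
proof -
  let ?P = "\<Sum>i<m. monom 1 (p ^ i) :: 'a poly"
  have p: "p > 1"
    using assms(1) prime_gt_1_nat by blast
  \<comment> \<open>This excludes \<open>m = 0\<close>, for which the trace would be an empty
    sum.\<close>
  have "CARD('a) \<noteq> 1"
    by (metis UNIV_I card_1_singletonE singletonD zero_neq_one)
  then obtain k where m: "m = Suc k"
    using assms(2) by (cases m) auto
  \<comment> \<open>Only the summand \<open>i = 0\<close> contributes to the linear coefficient, so
    the trace polynomial cannot vanish identically.\<close>
  have "coeff ?P 1 = (\<Sum>i<m. if i = 0 then 1 else 0)"
    unfolding coeff_sum by (rule sum.cong) (use p in auto)
  also have "\<dots> = 1"
    using m by simp
  finally have nz: "?P \<noteq> 0"
    by auto
  have "degree ?P \<le> p ^ k"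
    using p m by (intro degree_sum_le) (auto simp: degree_monom_eq less_Suc_eq_le intro: power_increasing)
  also have "p ^ k < CARD('a)"
    using p m assms(2) by simp
  finally have "card {x. poly ?P x = 0} < CARD('a)"
    using card_poly_roots_bound[OF nz] by linarith
  then have "{x. poly ?P x = 0} \<noteq> UNIV"
    by fastforce
  then obtain x where "poly ?P x \<noteq> 0"
    by blast
  then have "field_trace p m x \<noteq> 0"
    by (simp add: field_trace_def poly_sum poly_monom)
  then show ?thesis
    by (rule that)
qed

subsection \<open>Additive characters\<close>

text \<open>This is the canonical additive character of the field. Orthogonality and the eigenvector
  property rest only on its value at 0, its multiplicativity and its nontriviality.\<close>

definition trace_char :: "nat \<Rightarrow> nat \<Rightarrow> 'a::{field, finite} \<Rightarrow> complex"
  where "trace_char p m x = add_char p (field_trace p m x)"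

lemma trace_char_0:
  assumes "prime p" "CARD('a::{field, finite}) = p ^ m"
  shows "trace_char p m (0::'a) = 1"
proof -
  have p: "CHAR('a) = p" "p > 0"
    using CHAR_eq_of_CARD_prime_power[OF assms] assms(1) prime_gt_0_nat by auto
  have "field_trace p m (0::'a) = of_nat 0"
    using p(2) by (simp add: field_trace_def power_0_left)
  then show ?thesis
    using add_char_of_nat[OF p, of 0] by (simp add: trace_char_def)
qed

text \<open>Once both traces are written as \<open>of_nat\<close>, \<open>add_char_of_nat\<close>
  turns every value into an exponential. It accepts any natural number, so \<open>j + k\<close>
  needs no reduction modulo \<open>p\<close>.\<close>

lemma trace_char_add:
  fixes x y :: "'a::{field, finite}"
  assumes "prime p" "CARD('a) = p ^ m"
  shows "trace_char p m (x + y) = trace_char p m x * trace_char p m y"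
proof -
  have p: "CHAR('a) = p" "p > 0"
    using CHAR_eq_of_CARD_prime_power[OF assms] assms(1) prime_gt_0_nat by auto
  obtain j k where j: "field_trace p m x = of_nat j" and k: "field_trace p m y = of_nat k"
    using power_prime_eq_same_imp_of_nat[OF assms(1) p(1) field_trace_power[OF assms]] by metis
  have "field_trace p m (x + y) = of_nat (j + k)"
    using field_trace_add[OF assms(1) p(1)] j k by simp
  then show ?thesis
    unfolding trace_char_def j k
    by (simp only: add_char_of_nat[OF p]) (simp add: add_divide_distrib ring_distribs exp_add)
qed

lemma trace_char_nontrivial:
  assumes "prime p" "CARD('a) = p ^ m"
  obtains x :: "'a::{field, finite}" where "trace_char p m x \<noteq> 1"
proof -
  have p: "CHAR('a) = p" "p > 0"
    using CHAR_eq_of_CARD_prime_power[OF assms] assms(1) prime_gt_0_nat by auto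
  obtain x :: 'a where x: "field_trace p m x \<noteq> 0"
    using field_trace_nonzero[OF assms] .
  obtain j where j: "j < p" "field_trace p m x = of_nat j"
    using power_prime_eq_same_imp_of_nat[OF assms(1) p(1) field_trace_power[OF assms]] by metis
  have "j \<noteq> 0"
    using x j by (auto intro: Nat.gr0I)
  \<comment> \<open>The exponential is 1 only when \<open>j / p\<close> is an integer, which
    \<open>0 < j < p\<close> forbids.\<close>
  have "exp (2 * of_real pi * \<i> * of_nat j / of_nat p) \<noteq> (1::complex)"
  proof
    assume "exp (2 * of_real pi * \<i> * of_nat j / of_nat p) = (1::complex)"
    then obtain n :: int where "2 * pi * real j / real p = of_int (2 * n) * pi"
      by (auto simp: exp_eq_1)
    then have "real j = of_int n * real p"
      using p(2) by (simp add: field_simps)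
    then have "real_of_int (int j) = real_of_int (n * int p)"
      by simp
    then have "int j = n * int p"
      by (simp only: of_int_eq_iff)
    then have "int p dvd int j"
      by simp
    then have "p dvd j"
      by simp
    then show False
      using j(1) \<open>j \<noteq> 0\<close> by (simp add: nat_dvd_not_less)
  qed
  then have "trace_char p m x \<noteq> 1"
    unfolding trace_char_def j(2) by (simp add: add_char_of_nat[OF p])
  then show ?thesis
    by (rule that)
qed

lemma pairing_add_right: "pairing v (u + w) = pairing v u + pairing v w"
  by (simp add: pairing_def ring_distribs sum.distrib)

lemma pairing_add_left: "pairing (v + v') u = pairing v u + pairing v' u"
  by (simp add: pairing_def ring_distribs sum.distrib)

lemma pairing_0_left [simp]: "pairing 0 u = 0"
  by (simp add: pairing_def)

lemma pairing_0_right [simp]: "pairing v 0 = 0"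
  by (simp add: pairing_def)

lemma pairing_axis: "pairing v (axis i c) = v $ i * c"
proof -
  have "pairing v (axis i c) = (\<Sum>k\<in>UNIV. if k = i then v $ i * c else 0)"
    unfolding pairing_def by (rule sum.cong) (auto simp: axis_def)
  then show ?thesis
    by simp
qed

text \<open>Scaling the axis vector by \<open>x / v $ i\<close> makes the pairing equal to any
  prescribed \<open>x\<close>, in particular to one on which \<open>trace_char\<close> is not
  1.\<close>

lemma trace_char_pairing_axis_nontrivial:
  fixes v :: "('a::{field, finite}, 'k::finite) vec"
  assumes "prime p" "CARD('a) = p ^ m" "v $ i \<noteq> 0"
  obtains c where "trace_char p m (pairing v (axis i c)) \<noteq> 1"
proof -
  obtain x :: 'a where "trace_char p m x \<noteq> 1"
    using trace_char_nontrivial[OF assms(1,2)] .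
  then have "trace_char p m (pairing v (axis i (x / v $ i))) \<noteq> 1"
    using assms(3) by (simp add: pairing_axis)
  then show ?thesis
    by (rule that)
qed

text \<open>Translation by \<open>w\<close> permutes \<open>H\<close> and multiplies the sum by a
  factor other than 1. The set \<open>H\<close> is kept general to cover both the whole space and
  the subspace of vanishing first coordinates.\<close>

lemma sum_trace_char_pairing_eq_0:
  fixes v w :: "('a::{field, finite}, 'k::finite) vec"
  assumes "prime p" "CARD('a) = p ^ m"
    and w: "trace_char p m (pairing v w) \<noteq> 1"
    and H: "bij_betw ((+) w) H H"
  shows "(\<Sum>u\<in>H. trace_char p m (pairing v u)) = 0" (is "?S = 0")
proof -
  have "?S = (\<Sum>u\<in>H. trace_char p m (pairing v (w + u)))"
    using sum.reindex_bij_betw[OF H, of "\<lambda>u. trace_char p m (pairing v u)"] by simp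
  also have "\<dots> = trace_char p m (pairing v w) * ?S"
    by (simp add: pairing_add_right trace_char_add[OF assms(1,2)] sum_distrib_left)
  finally show ?thesis
    using w by simp
qed

lemma lookup_character:
  "Poly_Mapping.lookup (character p m v) u = trace_char p m (pairing v u)"
  by (simp add: character_def trace_char_def lookup_sum lookup_single when_def)

lemma inj_character:
  assumes "prime p" "CARD('a) = p ^ m"
  shows "inj (character p m :: ('a::{field, finite}, 'k::finite) vec \<Rightarrow> _)"
proof (rule injI, rule ccontr)
  fix v v' :: "('a, 'k) vec"
  assume eq: "character p m v = character p m v'" and "v \<noteq> v'"
  then obtain i where "(v - v') $ i \<noteq> 0"
    by (auto simp: vec_eq_iff)
  then obtain c where c: "trace_char p m (pairing (v - v') (axis i c)) \<noteq> 1"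
    using trace_char_pairing_axis_nontrivial[OF assms] by blast
  let ?u = "axis i c"
  have add: "trace_char p m (pairing (x + y) ?u) =
      trace_char p m (pairing x ?u) * trace_char p m (pairing y ?u)" for x y :: "('a, 'k) vec"
    by (simp add: pairing_add_left trace_char_add[OF assms])
  \<comment> \<open>Equal characters would make multiplication by the value for
    \<open>v - v'\<close>, which is not 1, fix the value for \<open>v'\<close>. That value would
    then be 0, although it has an inverse, namely the value for \<open>- v'\<close>.\<close>
  have "trace_char p m (pairing v' ?u) = trace_char p m (pairing v ?u)"
    using eq by (metis lookup_character)
  also have "\<dots> = trace_char p m (pairing (v - v') ?u) * trace_char p m (pairing v' ?u)"
    using add[of "v - v'" v'] by simp
  finally have "trace_char p m (pairing v' ?u) = 0"
    using c by simp
  moreover have "trace_char p m (pairing v' ?u) * trace_char p m (pairing (- v') ?u) = 1"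
    using add[of v' "- v'"] by (simp add: trace_char_0[OF assms])
  ultimately show False
    by simp
qed

lemma is_eigenvector_character:
  fixes g :: "('a::{field, finite}, 'k::finite) vec \<Rightarrow>\<^sub>0 complex"
  assumes "prime p" "CARD('a) = p ^ m"
    and c: "c = (\<Sum>w\<in>UNIV. Poly_Mapping.lookup g w * trace_char p m (pairing (- v) w))"
  shows "is_eigenvector (phi g) (character p m v) c"
proof -
  let ?\<chi> = "character p m v" and ?\<psi> = "trace_char p m"
  have "Poly_Mapping.lookup ?\<chi> 0 = 1"
    by (simp add: lookup_character trace_char_0[OF assms(1,2)])
  then have "?\<chi> \<noteq> 0"
    by auto
  moreover have "Poly_Mapping.lookup (g * ?\<chi>) u = c * Poly_Mapping.lookup ?\<chi> u" for u
  proof -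
    have shift: "pairing v (u - w) = pairing v u + pairing (- v) w" for w
      by (simp add: pairing_def algebra_simps sum_subtractf sum_negf)
    have "Poly_Mapping.lookup (g * ?\<chi>) u =
        (\<Sum>w\<in>UNIV. Poly_Mapping.lookup g (u - w) * ?\<psi> (pairing v w))"
      by (simp add: lookup_mult_group_algebra lookup_character)
    \<comment> \<open>Replacing \<open>w\<close> by \<open>u - w\<close> moves the shift from
      \<open>g\<close> to the character, where multiplicativity splits off a factor independent of
      \<open>w\<close>.\<close>
    also have "\<dots> = (\<Sum>w\<in>UNIV. Poly_Mapping.lookup g w * ?\<psi> (pairing v (u - w)))"
      by (rule sum.reindex_bij_witness[of _ "\<lambda>w. u - w" "\<lambda>w. u - w"]) auto
    also have "\<dots> = c * ?\<psi> (pairing v u)"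
      unfolding c shift
      by (simp add: trace_char_add[OF assms(1,2)] sum_distrib_left mult_ac)
    finally show ?thesis
      by (simp add: lookup_character)
  qed
  then have "g * ?\<chi> = scale c ?\<chi>"
    by (intro poly_mapping_eqI) (simp add: scale_def Poly_Mapping.map.rep_eq when_def)
  ultimately show ?thesis
    by (simp add: is_eigenvector_def phi_def)
qed

subsection \<open>Splitting the coordinates\<close>

lemma vec_eq_iff_coords: "u = v \<longleftrightarrow> first_coords u = first_coords v \<and> last_coords u = last_coords v"
proof -
  have "u $ k = v $ k" if "\<forall>i. u $ Inl i = v $ Inl i" "\<forall>j. u $ Inr j = v $ Inr j" for k
    using that by (cases k) auto
  then show ?thesis
    by (auto simp: first_coords_def last_coords_def vec_eq_iff)
qed

lemma first_coords_0 [simp]: "first_coords 0 = 0"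
  by (simp add: first_coords_def vec_eq_iff)

lemma last_coords_0 [simp]: "last_coords 0 = 0"
  by (simp add: last_coords_def vec_eq_iff)

lemma vec_eq_0_iff_coords: "v = 0 \<longleftrightarrow> first_coords v = 0 \<and> last_coords v = 0"
  using vec_eq_iff_coords[of v 0] by simp

lemma first_coords_case_sum [simp]: "first_coords (\<chi> k. case_sum f g k) = (\<chi> i. f i)"
  by (simp add: first_coords_def)

lemma last_coords_case_sum [simp]: "last_coords (\<chi> k. case_sum f g k) = (\<chi> j. g j)"
  by (simp add: last_coords_def)

text \<open>Padding with zeros in the first block inverts the projection.\<close>

lemma bij_betw_last_coords:
  "bij_betw last_coords {u :: ('a::zero, 'n::finite + 'd::finite) vec. first_coords u = 0} UNIV"
  by (rule bij_betw_byWitness[where f' = "\<lambda>a. \<chi> k. case_sum (\<lambda>_. 0) (($) a) k"])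
     (auto simp: vec_eq_iff_coords zero_vec_def)

lemma bij_betw_first_coords:
  "bij_betw first_coords {u :: ('a::zero, 'n::finite + 'd::finite) vec. last_coords u = 0} UNIV"
  by (rule bij_betw_byWitness[where f' = "\<lambda>a. \<chi> k. case_sum (($) a) (\<lambda>_. 0) k"])
     (auto simp: vec_eq_iff_coords zero_vec_def)

lemma card_first_coords_eq_0:
  "card {u :: ('a::{zero, finite}, 'n::finite + 'd::finite) vec. first_coords u = 0} = CARD('a) ^ CARD('d)"
  using bij_betw_same_card[OF bij_betw_last_coords] by simp

lemma card_last_coords_eq_0:
  "card {u :: ('a::{zero, finite}, 'n::finite + 'd::finite) vec. last_coords u = 0} = CARD('a) ^ CARD('n)"
  using bij_betw_same_card[OF bij_betw_first_coords] by simp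

section \<open>Character sums and the Fourier transform of \<open>f_coeff\<close>\<close>

lemma sum_trace_char_pairing_UNIV:
  fixes v :: "('a::{field, finite}, 'k::finite) vec"
  assumes "prime p" "CARD('a) = p ^ m"
  shows "(\<Sum>u\<in>UNIV. trace_char p m (pairing v u)) = (if v = 0 then of_nat CARD('a) ^ CARD('k) else 0)"
proof (cases "v = 0")
  case True
  then show ?thesis
    by (simp add: trace_char_0[OF assms])
next
  case False
  then obtain i where "v $ i \<noteq> 0"
    by (auto simp: vec_eq_iff)
  then obtain c where c: "trace_char p m (pairing v (axis i c)) \<noteq> 1"
    using trace_char_pairing_axis_nontrivial[OF assms] by blast
  have "bij ((+) (axis i c :: ('a, 'k) vec))"
    by simp
  then show ?thesis
    using sum_trace_char_pairing_eq_0[OF assms c] False by simp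
qed

text \<open>If \<open>last_coords v = 0\<close>, then \<open>v\<close> and each \<open>u\<close> in
  the subspace have disjoint supports, so every term is 1. Otherwise an axis vector in the last
  block lies in the subspace and can serve as a translation with nontrivial character value.\<close>

lemma sum_trace_char_pairing_first_coords_eq_0:
  fixes v :: "('a::{field, finite}, 'n::finite + 'd::finite) vec"
  assumes "prime p" "CARD('a) = p ^ m"
  shows "(\<Sum>u | first_coords u = 0. trace_char p m (pairing v u)) =
    (if last_coords v = 0 then of_nat CARD('a) ^ CARD('d) else 0)"
proof (cases "last_coords v = 0")
  case True
  have "pairing v u = 0" if "first_coords u = 0" for u
    unfolding pairing_def
  proof (rule sum.neutral, rule ballI)
    fix k
    show "v $ k * u $ k = 0"
      using that True by (cases k) (auto simp: first_coords_def last_coords_def vec_eq_iff)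
  qed
  then have "(\<Sum>u | first_coords u = 0. trace_char p m (pairing v u)) =
      (\<Sum>u :: ('a, 'n + 'd) vec | first_coords u = 0. 1)"
    by (intro sum.cong) (auto simp: trace_char_0[OF assms])
  then show ?thesis
    using True by (simp add: card_first_coords_eq_0)
next
  case False
  then obtain j where "v $ Inr j \<noteq> 0"
    by (auto simp: vec_eq_iff last_coords_def)
  then obtain c where c: "trace_char p m (pairing v (axis (Inr j) c)) \<noteq> 1"
    using trace_char_pairing_axis_nontrivial[OF assms] by blast
  let ?w = "axis (Inr j) c" and ?H = "{u :: ('a, 'n + 'd) vec. first_coords u = 0}"
  have "bij_betw ((+) ?w) ?H ?H"
    by (rule bij_betw_byWitness[where f' = "\<lambda>u. u - ?w"])
       (auto simp: first_coords_def vec_eq_iff axis_def)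
  then show ?thesis
    using sum_trace_char_pairing_eq_0[OF assms c] False by simp
qed

lemma sum_f_coeff_trace_char:
  fixes v :: "('a::{field, finite}, 'n::finite + 'd::finite) vec"
  assumes "prime p" "CARD('a) = p ^ m"
  shows "(\<Sum>u\<in>UNIV. f_coeff u * trace_char p m (pairing v u)) =
    (if v = 0 then of_nat CARD('a) ^ ((CARD('d) + 1) * CARD('n))
     else if last_coords v = 0 then 0 else of_nat CARD('a) ^ (CARD('d) * CARD('n)))"
proof -
  let ?q = "of_nat CARD('a) :: complex" and ?\<psi> = "\<lambda>u. trace_char p m (pairing v u)"
  let ?H = "{u :: ('a, 'n + 'd) vec. first_coords u = 0}"
  define A B where "A = ?q ^ (CARD('d) * CARD('n))" and "B = ?q ^ (CARD('d) * (CARD('n) - 1))"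
  \<comment> \<open>The exponents satisfy \<open>d * n = d * (n - 1) + d\<close> because
    \<open>n\<close>, the cardinality of a type, is positive.\<close>
  have AB: "A = B * ?q ^ CARD('d)"
    unfolding A_def B_def
    by (metis One_nat_def Suc_pred mult_Suc_right power_add zero_less_card_finite mult.commute)
  \<comment> \<open>The coefficient function is \<open>A\<close> times the indicator of 0 plus
    \<open>B\<close> times the indicator of the complement of \<open>?H\<close>. At
    \<open>u = 0\<close> the two \<open>B\<close> terms cancel, since 0 lies in
    \<open>?H\<close>.\<close>
  have "f_coeff u * ?\<psi> u = (if u = 0 then A else 0) + B * ?\<psi> u - B * (if u \<in> ?H then ?\<psi> u else 0)" for u
    by (auto simp: f_coeff_def A_def B_def trace_char_0[OF assms])
  then have "(\<Sum>u\<in>UNIV. f_coeff u * ?\<psi> u) =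
      A + B * (\<Sum>u\<in>UNIV. ?\<psi> u) - B * (\<Sum>u\<in>UNIV. if u \<in> ?H then ?\<psi> u else 0)"
    by (simp add: sum.distrib sum_subtractf flip: sum_distrib_left)
  also have "(\<Sum>u\<in>UNIV. if u \<in> ?H then ?\<psi> u else 0) = (\<Sum>u\<in>?H. ?\<psi> u)"
    by (subst sum.inter_restrict[symmetric]) auto
  finally have "(\<Sum>u\<in>UNIV. f_coeff u * ?\<psi> u) = A
      + B * (if v = 0 then ?q ^ (CARD('n) + CARD('d)) else 0)
      - B * (if last_coords v = 0 then ?q ^ CARD('d) else 0)"
    by (simp add: sum_trace_char_pairing_UNIV[OF assms]
        sum_trace_char_pairing_first_coords_eq_0[OF assms])
  moreover have "B * ?q ^ (CARD('n) + CARD('d)) = ?q ^ ((CARD('d) + 1) * CARD('n))"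
  proof -
    have "B * ?q ^ (CARD('n) + CARD('d)) = A * ?q ^ CARD('n)"
      by (simp add: AB power_add)
    then show ?thesis
      by (simp add: A_def power_add)
  qed
  \<comment> \<open>If \<open>last_coords v\<close> is nonzero, only \<open>A\<close> survives.
    Otherwise \<open>A\<close> cancels against \<open>B * ?q ^ CARD('d)\<close>, leaving the
    full-space term, which is nonzero only for \<open>v = 0\<close>.\<close>
  ultimately show ?thesis
    using AB by (auto simp: vec_eq_0_iff_coords A_def)
qed

theorem theorem3p4:
  fixes p m q n d :: nat
    and F :: "('a::{field, finite}, 'n::finite + 'd::finite) vec \<Rightarrow>\<^sub>0 complex"
    and X :: "('a, 'n + 'd) vec \<Rightarrow> (('a, 'n + 'd) vec \<Rightarrow>\<^sub>0 complex)"
  assumes "prime p" and "q = p ^ m" and "CARD('a) = q"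
    and "n = CARD('n)" and "d = CARD('d)"
    and F: "F = f_elem" and X: "X = character p m"
  shows "is_eigenvector (phi F) (X 0) (of_nat q ^ ((d + 1) * n))
    \<and> (\<forall>v. last_coords v \<noteq> 0 \<longrightarrow> is_eigenvector (phi F) (X v) (of_nat q ^ (d * n)))
    \<and> card (X ` {v. last_coords v \<noteq> 0}) = q ^ (n + d) - q ^ n
    \<and> (\<forall>v. v \<noteq> 0 \<and> last_coords v = 0 \<longrightarrow> is_eigenvector (phi F) (X v) 0)
    \<and> card (X ` {v. v \<noteq> 0 \<and> last_coords v = 0}) = q ^ n - 1"
proof -
  have q: "CARD('a) = p ^ m"
    using assms by simp
  note pq = \<open>prime p\<close> q
  have lookup_F: "Poly_Mapping.lookup F u = f_coeff u" for u
    by (simp add: F f_elem_def lookup_sum lookup_single when_def)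
  have eigen: "is_eigenvector (phi F) (X v)
      (if v = 0 then of_nat q ^ ((d + 1) * n)
       else if last_coords v = 0 then 0 else of_nat q ^ (d * n))" for v
  proof -
    \<comment> \<open>The eigenvalue is the Fourier coefficient at \<open>- v\<close>, and the case
      distinction is invariant under negation.\<close>
    have "last_coords (- v) = 0 \<longleftrightarrow> last_coords v = 0"
      by (simp add: last_coords_def vec_eq_iff)
    then show ?thesis
      unfolding X
      by (intro is_eigenvector_character[OF pq])
         (simp add: lookup_F sum_f_coeff_trace_char[OF pq] assms(4,5) flip: assms(3))
  qed
  let ?Z = "{v :: ('a, 'n + 'd) vec. last_coords v = 0}"
  \<comment> \<open>Injectivity of \<open>X\<close> reduces counting characters to counting
    vectors.\<close>
  have card_X: "card (X ` S) = card S" for S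
    unfolding X using inj_character[OF pq] by (intro card_image) (rule inj_on_subset, auto)
  have card_Z: "card ?Z = q ^ n"
    using card_last_coords_eq_0 assms(3,4) by metis
  have "{v. last_coords v \<noteq> 0} = UNIV - ?Z"
    by auto
  then have "card {v :: ('a, 'n + 'd) vec. last_coords v \<noteq> 0} = q ^ (n + d) - q ^ n"
    using card_Z assms(3,4,5) by (simp add: card_Diff_subset)
  moreover have "{v. v \<noteq> 0 \<and> last_coords v = 0} = ?Z - {0}"
    by auto
  then have "card {v :: ('a, 'n + 'd) vec. v \<noteq> 0 \<and> last_coords v = 0} = q ^ n - 1"
    using card_Z by simp
  moreover have "is_eigenvector (phi F) (X v) (of_nat q ^ (d * n))" if "last_coords v \<noteq> 0" for v
    using eigen[of v] that by (auto split: if_splits)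
  moreover have "is_eigenvector (phi F) (X v) 0" if "v \<noteq> 0" "last_coords v = 0" for v
    using eigen[of v] that by simp
  ultimately show ?thesis
    using eigen[of 0] by (simp add: card_X)
qed

end
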